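(* Fix $\eta>0$. For $q\in(0,1)$ sufficiently close to $1$ set $\xi=(1-q)\eta$, let $\{\pi_n\}_{n\ge0}$ be the monic orthogonal polynomials on the unit circle with respect to the weight $\mathbb{I}(z)=\prod_{k\ge0}\big[(1-\xi q^{k+\frac12}z)(1-\xi q^{k+\frac12}z^{-1})\big]^{-1}$, and let $x_n$ denote the limit of $\pi_n(0)$ as $q\to1$ from below. Then for all $n\ge1$ the discrete Painlevé II equation holds: $$(x_{n-1}+x_{n+1})(1-x_n^2)+\frac n\eta x_n=0.$$
   Context: The monic orthogonal polynomials with respect to a continuous positive weight $w$ on the unit circle $\mathbb{T}$ are the unique monic polynomials $\pi_n$ of degree $n=0,1,2,\dots$ that are pairwise orthogonal for $\langle f,g\rangle=\oint_{\mathbb{T}}f(z)\overline{g(z)}w(z)\frac{dz}{2\pi iz}$. *)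

theory Defs
  imports "HOL-Complex_Analysis.Complex_Analysis" "HOL-Computational_Algebra.Polynomial"
begin

definition circle_inner :: "(complex \<Rightarrow> complex) \<Rightarrow> complex poly \<Rightarrow> complex poly \<Rightarrow> complex" where
  "circle_inner w f g =
     contour_integral (circlepath 0 1)
       (\<lambda>z. poly f z * cnj (poly g z) * w z / (2 * of_real pi * \<i> * z))"

definition monic_orthogonal :: "(complex \<Rightarrow> complex) \<Rightarrow> (nat \<Rightarrow> complex poly) \<Rightarrow> bool" where
  "monic_orthogonal w P \<longleftrightarrow>
     (\<forall>n. degree (P n) = n \<and> lead_coeff (P n) = 1) \<and>
     (\<forall>m n. m \<noteq> n \<longrightarrow> circle_inner w (P m) (P n) = 0)"

(* Meaningful for weights that are continuous and positive on the unit circle,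
   for which the sequence exists and is unique. *)
definition opuc :: "(complex \<Rightarrow> complex) \<Rightarrow> nat \<Rightarrow> complex poly" where
  "opuc w = (THE P. monic_orthogonal w P)"

definition I_weight :: "real \<Rightarrow> real \<Rightarrow> complex \<Rightarrow> complex" where
  "I_weight q \<xi> z =
     (\<Prod>k. inverse ((1 - of_real (\<xi> * q powr (real k + 1/2)) * z) *
                   (1 - of_real (\<xi> * q powr (real k + 1/2)) * inverse z)))"

end

(* The Verblunsky coefficients pi_n(0) are rational functions of the moments of the weight, by the
   Szego recursion. As q -> 1 the weight converges uniformly on the circle to exp(eta (z + 1/z)):
   the factors have parameters a_k with sum eta sqrt q, and their logarithms are 2 a_k Re z up
   to O(a_k^2), which sums to O(1 - q). Hence x_n = pi_n(0) for the limit weight. For that weight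
   integrating the derivative of z |-> f(z) g(1/z) exp(eta (z + 1/z)) along the circle gives a linear
   identity between inner products, and f = pi_n, g = z^n pi_n(1/z) turns it into discrete
   Painleve II. *)

theory Submission
  imports Defs
begin

section \<open>Real Toeplitz forms and the Szego recursion\<close>

text \<open>\<open>shift\<close> is the Toeplitz property: multiplication by z preserves the form.
  Real coefficients suffice because the weights in question are invariant under z -> 1/z on the
  circle.\<close>

locale toeplitz_form =
  fixes B :: "real poly \<Rightarrow> real poly \<Rightarrow> real"
  assumes add_left: "B (f + g) h = B f h + B g h"
    and smult_left: "B (smult a f) h = a * B f h"
    and commute: "B f g = B g f"
    and shift: "B (pCons 0 f) (pCons 0 g) = B f g"
    and pos: "f \<noteq> 0 \<Longrightarrow> 0 < B f f"

text \<open>The components are the monic orthogonal polynomial \<open>p\<close> of degree \<open>n\<close> and its reversal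
  \<open>z\<^sup>n p (1/z)\<close>.\<close>

primrec szego :: "(real poly \<Rightarrow> real poly \<Rightarrow> real) \<Rightarrow> nat \<Rightarrow> real poly \<times> real poly" where
  "szego B 0 = (1, 1)"
| "szego B (Suc n) =
     (let (p, r) = szego B n; a = - B (pCons 0 p) 1 / B r 1
      in (pCons 0 p + smult a r, r + smult a (pCons 0 p)))"

definition orth :: "(real poly \<Rightarrow> real poly \<Rightarrow> real) \<Rightarrow> nat \<Rightarrow> real poly" where
  "orth B n = fst (szego B n)"

definition orth_rev :: "(real poly \<Rightarrow> real poly \<Rightarrow> real) \<Rightarrow> nat \<Rightarrow> real poly" where
  "orth_rev B n = snd (szego B n)"

definition verblunsky :: "(real poly \<Rightarrow> real poly \<Rightarrow> real) \<Rightarrow> nat \<Rightarrow> real" where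
  "verblunsky B n = coeff (orth B n) 0"

lemma orth_0 [simp]: "orth B 0 = 1" and orth_rev_0 [simp]: "orth_rev B 0 = 1"
  by (simp_all add: orth_def orth_rev_def)

lemma coeff_orth_rev_0 [simp]: "coeff (orth_rev B n) 0 = 1"
  by (induction n) (simp_all add: orth_rev_def Let_def case_prod_beta)

text \<open>The recursion coefficient is the new constant term, since \<open>pCons 0\<close>
  contributes none and the reversal has constant term 1.\<close>

lemma verblunsky_Suc: "verblunsky B (Suc n) = - B (pCons 0 (orth B n)) 1 / B (orth_rev B n) 1"
  using coeff_orth_rev_0[of B n]
  by (simp add: verblunsky_def orth_def orth_rev_def Let_def case_prod_beta)

lemma orth_Suc: "orth B (Suc n) = pCons 0 (orth B n) + smult (verblunsky B (Suc n)) (orth_rev B n)"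
  by (simp only: verblunsky_Suc) (simp add: orth_def orth_rev_def Let_def case_prod_beta)

lemma orth_rev_Suc:
  "orth_rev B (Suc n) = orth_rev B n + smult (verblunsky B (Suc n)) (pCons 0 (orth B n))"
  by (simp only: verblunsky_Suc) (simp add: orth_def orth_rev_def Let_def case_prod_beta)

text \<open>The three facts are proved together: monicity at \<open>Suc n\<close> needs the degree
  bound on the reversal at \<open>n\<close>, so that its coefficient at \<open>Suc n\<close>
  vanishes.\<close>

lemma degree_orth_aux: "degree (orth B n) \<le> n \<and> degree (orth_rev B n) \<le> n \<and> coeff (orth B n) n = 1"
proof (induction n)
  case (Suc n)
  have "degree (pCons 0 (orth B n)) \<le> Suc n"
    using Suc by (simp add: degree_pCons_eq_if)
  moreover have "coeff (orth_rev B n) (Suc n) = 0"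
    using Suc by (intro coeff_eq_0) auto
  ultimately show ?case
    using Suc unfolding orth_Suc orth_rev_Suc
    by (auto intro!: degree_add_le order.trans[OF degree_smult_le])
qed auto

lemma lead_coeff_orth [simp]: "coeff (orth B n) n = 1"
  and degree_orth_le: "degree (orth B n) \<le> n"
  and degree_orth_rev: "degree (orth_rev B n) \<le> n"
  using degree_orth_aux by auto

lemma degree_orth [simp]: "degree (orth B n) = n"
  using degree_orth_le[of B n] le_degree[of "orth B n" n] by simp

lemma coeff_orth_rev_top [simp]: "coeff (orth_rev B n) n = verblunsky B n"
proof (cases n)
  case 0
  then show ?thesis by (simp add: verblunsky_def)
next
  case (Suc m)
  have "coeff (orth_rev B m) (Suc m) = 0"
    using degree_orth_rev[of B m] by (intro coeff_eq_0) auto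
  then show ?thesis
    unfolding Suc orth_rev_Suc by simp
qed

section \<open>Orthogonality and discrete Painleve II for a Toeplitz form\<close>

context toeplitz_form
begin

abbreviation "P \<equiv> orth B"
abbreviation "Q \<equiv> orth_rev B"
abbreviation "\<alpha> \<equiv> verblunsky B"

lemma add_right: "B f (g + h) = B f g + B f h"
  using add_left commute by metis

lemma smult_right: "B f (smult a g) = a * B f g"
  using smult_left commute by metis

lemma diff_left: "B (f - g) h = B f h - B g h"
  using add_left[of "f - g" g h] by simp

lemma diff_right: "B f (g - h) = B f g - B f h"
  using diff_left commute by metis

lemma zero_right: "B f 0 = 0"
  using smult_right[of f 0 0] by simp

lemma sum_right: "B f (\<Sum>i\<in>A. g i) = (\<Sum>i\<in>A. B f (g i))"
  by (induction A rule: infinite_finite_induct) (simp_all add: zero_right add_right)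

lemma expand_right:
  assumes "degree g \<le> n"
  shows "B f g = (\<Sum>i\<le>n. coeff g i * B f (monom 1 i))"
proof -
  have "g = (\<Sum>i\<le>n. smult (coeff g i) (monom 1 i))"
    using poly_as_sum_of_monoms'[OF assms] by (simp add: smult_monom)
  then have "B f g = B f (\<Sum>i\<le>n. smult (coeff g i) (monom 1 i))"
    by simp
  then show ?thesis by (simp only: sum_right smult_right)
qed

lemma monom_shift: "B (monom 1 (i + d)) (monom 1 (j + d)) = B (monom 1 i) (monom 1 j)"
  by (induction d) (simp_all add: monom_Suc shift)

text \<open>Shift invariance leaves only the dependence on k - j, and commutativity allows its sign
  to flip. The hypothesis is k - j = l - m, written without truncated subtraction.\<close>

lemma monom_toeplitz:
  assumes "k + m = j + l"
  shows "B (monom 1 j) (monom 1 k) = B (monom 1 l) (monom 1 m)"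
proof (cases "j \<le> k")
  case True
  then have "k = (k - j) + j" "l = (k - j) + m" using assms by auto
  then show ?thesis
    using monom_shift[of 0 j "k - j"] monom_shift[of "k - j" m 0] commute by (metis add_0)
next
  case False
  then have "j = (j - k) + k" "m = (j - k) + l" using assms by auto
  then show ?thesis
    using monom_shift[of "j - k" k 0] monom_shift[of 0 l "j - k"] commute by (metis add_0)
qed

text \<open>Both sides are inner products with monomials, reflected by \<open>z \<mapsto> 1/z\<close>. Stating this for
  all monomial factors makes the induction through the recursion go through.\<close>

lemma reflection:
  "k + m = n + j + l \<Longrightarrow> B (monom 1 j * P n) (monom 1 k) = B (monom 1 l * Q n) (monom 1 m)"
proof (induction n arbitrary: j k l m)
  case 0
  then show ?case using monom_toeplitz[of k m j l] by simp
next
  case (Suc n)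
  have X: "monom 1 i * pCons 0 p = monom 1 (Suc i) * p" for i and p :: "real poly"
    by (simp add: monom_Suc)
  have "B (monom 1 j * P (Suc n)) (monom 1 k)
      = B (monom 1 (Suc j) * P n) (monom 1 k) + \<alpha> (Suc n) * B (monom 1 j * Q n) (monom 1 k)"
    by (simp only: orth_Suc distrib_left mult_smult_right add_left smult_left X)
  \<comment> \<open>Reflection exchanges the two summands of the recursion for \<open>P\<close> with
    those of the recursion for \<open>Q\<close>; the second exchange uses the induction hypothesis
    backwards.\<close>
  also have "B (monom 1 (Suc j) * P n) (monom 1 k) = B (monom 1 l * Q n) (monom 1 m)"
    using Suc.prems by (intro Suc.IH) simp
  also have "B (monom 1 j * Q n) (monom 1 k) = B (monom 1 (Suc l) * P n) (monom 1 m)"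
    using Suc.prems by (intro Suc.IH[symmetric]) simp
  finally show ?case
    by (simp only: orth_rev_Suc distrib_left mult_smult_right add_left smult_left X)
qed

lemma reflection': "k \<le> n \<Longrightarrow> B (Q n) (monom 1 k) = B (P n) (monom 1 (n - k))"
  using reflection[of "n - k" k n 0 0] by simp

text \<open>The two claims support each other: positivity at \<open>n\<close> makes the denominator
  \<open>B (Q n) 1\<close> of the next coefficient nonzero, and orthogonality at
  \<open>Suc n\<close> identifies the next pairing with a squared norm.\<close>

lemma orth_monom: "\<forall>k<n. B (P n) (monom 1 k) = 0"
  and orth_monom_pos: "B (P n) (monom 1 n) > 0"
proof (induction n)
  case (Suc n)
  { case 1
    show ?case
    proof safe
      fix k assume k: "k < Suc n"
      have nz: "B (Q n) 1 \<noteq> 0"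
        using Suc(2) reflection'[of 0 n] by simp
      show "B (P (Suc n)) (monom 1 k) = 0"
      \<comment> \<open>Orthogonality to 1 is what the choice of the recursion coefficient enforces.
        For higher powers both summands vanish separately, one by \<open>shift\<close>, the other by
        reflection.\<close>
      proof (cases k)
        case 0
        then show ?thesis
          using nz unfolding orth_Suc add_left smult_left verblunsky_Suc by simp
      next
        case (Suc i)
        have "B (pCons 0 (P n)) (monom 1 k) = 0"
          using Suc.IH(1) k unfolding Suc monom_Suc shift by simp
        moreover have "B (Q n) (monom 1 k) = 0"
          using Suc.IH(1) k Suc by (subst reflection') auto
        ultimately show ?thesis
          unfolding orth_Suc add_left smult_left by simp
      qed
    qed
  note orth = this }
  case 2
  have "B (P (Suc n)) (P (Suc n)) = (\<Sum>i\<le>Suc n. coeff (P (Suc n)) i * B (P (Suc n)) (monom 1 i))"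
    by (rule expand_right) simp
  also have "\<dots> = B (P (Suc n)) (monom 1 (Suc n))"
    using \<open>\<forall>k<Suc n. B (P (Suc n)) (monom 1 k) = 0\<close> by (simp add: lessThan_Suc_atMost[symmetric])
  finally show ?case
    using pos[of "P (Suc n)"] degree_orth[of B "Suc n"] by (metis Zero_not_Suc degree_0)
qed (use pos[of 1] in auto)


text \<open>This is the squared norm of \<open>P n\<close>: its lower-order terms are orthogonal to
  it.\<close>

definition "h n = B (P n) (monom 1 n)"

lemma h_pos: "h n > 0"
  using orth_monom_pos by (simp add: h_def)

lemma orth_inner:
  assumes "degree g \<le> n"
  shows "B (P n) g = coeff g n * h n"
proof -
  have "B (P n) g = (\<Sum>i\<le>n. coeff g i * B (P n) (monom 1 i))"
    by (rule expand_right) fact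
  then show ?thesis
    using orth_monom[of n] by (simp add: lessThan_Suc_atMost[symmetric] h_def)
qed

text \<open>Reflection turns orthogonality of \<open>P n\<close> to the powers 0 to n - 1 into
  orthogonality of \<open>Q n\<close> to the powers 1 to n, so only the constant term
  contributes.\<close>

lemma orth_rev_inner:
  assumes "degree g \<le> n"
  shows "B (Q n) g = coeff g 0 * h n"
proof -
  have "B (Q n) g = (\<Sum>i\<le>n. coeff g i * B (Q n) (monom 1 i))"
    by (rule expand_right) fact
  also have "\<dots> = (\<Sum>i\<le>n. if i = 0 then coeff g 0 * h n else 0)"
    using orth_monom[of n] by (intro sum.cong) (auto simp: reflection' h_def)
  finally show ?thesis by simp
qed

lemma orth_rev_inner_1: "B (Q n) 1 = h n"
  using orth_rev_inner[of 1 n] by simp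

lemma orthogonal: "m \<noteq> n \<Longrightarrow> B (P m) (P n) = 0"
proof (induction m n rule: linorder_wlog)
  case (le m n)
  then show ?case
    using orth_inner[of "P m" n] by (simp add: commute[of "P m"] coeff_eq_0)
next
  case (sym m n)
  then show ?case by (simp add: commute)
qed

text \<open>For \<open>f = P n\<close> and \<open>g = Q n\<close> every inner product in
  \<open>parts\<close> reduces to a multiple of \<open>h n\<close> with coefficients in \<alpha>;
  cancelling \<open>h n > 0\<close> leaves the recurrence.\<close>

theorem discrete_painleve:
  assumes parts: "\<And>f g. B (pCons 0 (pderiv f)) g - B f (pCons 0 (pderiv g))
      + \<eta> * (B (pCons 0 f) g - B f (pCons 0 g)) = 0"
    and "n \<ge> 1"
  shows "\<eta> * ((\<alpha> (n - 1) + \<alpha> (n + 1)) * (1 - (\<alpha> n)\<^sup>2)) + real n * \<alpha> n = 0"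
proof -
  obtain m where n: "n = Suc m"
    using assms by (cases n) auto
  have deg_D: "degree (pCons 0 (pderiv f)) \<le> n" if "degree f \<le> n" for f :: "real poly"
    using that n by (auto simp add: degree_pCons_eq_if degree_pderiv)
  have zP: "pCons 0 (P n) = P (Suc n) - smult (\<alpha> (Suc n)) (Q n)"
    by (simp add: orth_Suc)
  \<comment> \<open>Eliminating \<open>pCons 0 (P m)\<close> between the two recursions expresses
    \<open>Q n\<close> through \<open>Q m\<close> and \<open>P n\<close>. This is the source of the
    factor 1 - x_n^2, and it lowers the degree enough for \<open>orth_inner\<close> to apply to
    \<open>pCons 0 (Q m)\<close>.\<close>
  have zQ: "pCons 0 (Q n) = smult (1 - (\<alpha> n)\<^sup>2) (pCons 0 (Q m)) + smult (\<alpha> n) (pCons 0 (P n))"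
    unfolding n orth_Suc[of B m] orth_rev_Suc[of B m]
    by (simp add: smult_add_right smult_diff_left power2_eq_square add_ac
        flip: smult_add_left)
  have PQ: "B (P n) (Q n) = \<alpha> n * h n"
    using orth_inner[of "Q n" n] degree_orth_rev[of B n] by simp
  have QQ: "B (Q n) (Q n) = h n"
    using orth_rev_inner[of "Q n" n] degree_orth_rev[of B n] by simp
  have PQ_Suc: "B (P (Suc n)) (Q n) = 0"
    using orth_inner[of "Q n" "Suc n"] degree_orth_rev[of B n] by (simp add: coeff_eq_0)
  \<comment> \<open>The operator z d/dz kills the constant term, the only one that
    \<open>Q n\<close> sees.\<close>
  have 1: "B (pCons 0 (pderiv (P n))) (Q n) = 0"
    using orth_rev_inner[of "pCons 0 (pderiv (P n))" n] deg_D[of "P n"] by (simp add: commute)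
  \<comment> \<open>The operator z d/dz multiplies the top coefficient, which is
    \<open>\<alpha> n\<close>, by \<open>n\<close>; this produces the linear term of the
    equation.\<close>
  have 2: "B (P n) (pCons 0 (pderiv (Q n))) = real n * \<alpha> n * h n"
    using orth_inner[of "pCons 0 (pderiv (Q n))" n] deg_D[of "Q n"] degree_orth_rev[of B n]
    by (simp add: n coeff_pderiv flip: coeff_orth_rev_top)
  have 3: "B (pCons 0 (P n)) (Q n) = - \<alpha> (Suc n) * h n"
    by (simp add: zP diff_left smult_left QQ PQ_Suc)
  have 4: "B (P n) (pCons 0 (P n)) = - \<alpha> (Suc n) * \<alpha> n * h n"
    using orthogonal[of "Suc n" n] PQ
    by (simp add: zP diff_right smult_right commute[of "P n" "P (Suc n)"])
  have 5: "B (P n) (pCons 0 (Q m)) = \<alpha> m * h n"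
    using orth_inner[of "pCons 0 (Q m)" n] degree_orth_rev[of B m]
    by (simp add: n degree_pCons_eq_if)
  have "B (P n) (pCons 0 (Q n)) = (1 - (\<alpha> n)\<^sup>2) * \<alpha> m * h n - (\<alpha> n)\<^sup>2 * \<alpha> (Suc n) * h n"
    unfolding zQ add_right smult_right 4 5 by (simp add: power2_eq_square)
  with parts[of "P n" "Q n"] 1 2 3
  have "(\<eta> * ((\<alpha> m + \<alpha> (Suc n)) * (1 - (\<alpha> n)\<^sup>2)) + real n * \<alpha> n) * h n = 0"
    by (simp add: algebra_simps)
  then show ?thesis
    using h_pos[of n] n by simp
qed

end

section \<open>Continuity of the Szego recursion in the moments\<close>

text \<open>The recursion pairs polynomials only with 1, so it is rational in these moments, and the
  limit of each denominator is the squared norm \<open>h n > 0\<close>.\<close>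

lemma szego_tendsto:
  assumes B: "toeplitz_form B" and C: "\<forall>\<^sub>F q in F. toeplitz_form (C q)"
    and moments: "\<And>i. ((\<lambda>q. C q (monom 1 i) 1) \<longlongrightarrow> B (monom 1 i) 1) F"
  shows "((\<lambda>q. coeff (orth (C q) n) i) \<longlongrightarrow> coeff (orth B n) i) F"
    and "((\<lambda>q. coeff (orth_rev (C q) n) i) \<longlongrightarrow> coeff (orth_rev B n) i) F"
proof (induction n arbitrary: i)
  case 0
  { case 1 then show ?case by simp }
  { case 2 then show ?case by simp }
next
  case (Suc n)
  interpret toeplitz_form B by fact
  have exp: "A f 1 = (\<Sum>i\<le>m. coeff f i * A (monom 1 i) 1)"
    if "toeplitz_form A" "degree f \<le> m" for A f m
    using toeplitz_form.expand_right[OF that, of 1] by (simp add: toeplitz_form.commute[OF that(1), of _ 1])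
  \<comment> \<open>A degree bound independent of \<open>q\<close> turns the pairing into a sum of
    fixed length, whose limit can be taken termwise.\<close>
  have lim: "((\<lambda>q. C q (f q) 1) \<longlongrightarrow> B g 1) F"
    if f: "\<And>i. ((\<lambda>q. coeff (f q) i) \<longlongrightarrow> coeff g i) F"
      and deg: "\<And>q. degree (f q) \<le> m" "degree g \<le> m" for f g m
  proof -
    have "((\<lambda>q. \<Sum>i\<le>m. coeff (f q) i * C q (monom 1 i) 1) \<longlongrightarrow> B g 1) F"
      unfolding exp[OF B deg(2)] by (intro tendsto_intros f moments)
    moreover have "\<forall>\<^sub>F q in F. (\<Sum>i\<le>m. coeff (f q) i * C q (monom 1 i) 1) = C q (f q) 1"
      using C by eventually_elim (simp add: exp[OF _ deg(1)])
    ultimately show ?thesis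
      by (rule Lim_transform_eventually)
  qed
  have "((\<lambda>q. C q (pCons 0 (orth (C q) n)) 1) \<longlongrightarrow> B (pCons 0 (orth B n)) 1) F"
    using Suc.IH(1) by (intro lim[where m = "Suc n"])
      (auto simp: coeff_pCons degree_pCons_eq_if split: nat.split)
  moreover have "((\<lambda>q. C q (orth_rev (C q) n) 1) \<longlongrightarrow> B (orth_rev B n) 1) F"
    using Suc.IH(2) by (rule lim) (rule degree_orth_rev)+
  ultimately have v: "((\<lambda>q. verblunsky (C q) (Suc n)) \<longlongrightarrow> verblunsky B (Suc n)) F"
    unfolding verblunsky_Suc using h_pos[of n] orth_rev_inner_1[of n]
    by (intro tendsto_intros) auto
  have zP: "((\<lambda>q. coeff (pCons 0 (orth (C q) n)) i) \<longlongrightarrow> coeff (pCons 0 (orth B n)) i) F" for i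
    using Suc.IH(1) by (cases i) auto
  { case 1
    show ?case
      unfolding orth_Suc coeff_add coeff_smult by (intro tendsto_intros v zP Suc.IH) }
  { case 2
    show ?case
      unfolding orth_rev_Suc coeff_add coeff_smult by (intro tendsto_intros v zP Suc.IH) }
qed

section \<open>Inner products for symmetric weights on the circle\<close>

definition cinner :: "(real \<Rightarrow> real) \<Rightarrow> complex poly \<Rightarrow> complex poly \<Rightarrow> complex" where
  "cinner V f g = integral {0..1}
     (\<lambda>t. poly f (cis (2 * pi * t)) * cnj (poly g (cis (2 * pi * t))) * of_real (V t))"

text \<open>For z = exp(2 pi i t) the measure dz / (2 pi i z) becomes dt.\<close>

lemma circle_inner_eq_cinner:
  assumes "\<forall>t\<in>{0..1}. w (cis (2 * pi * t)) = of_real (V t)"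
  shows "circle_inner w f g = cinner V f g"
proof -
  have "circlepath 0 1 t = cis (2 * pi * t)" for t
    by (simp add: circlepath cis_conv_exp mult_ac)
  moreover have "vector_derivative (circlepath 0 1) (at t) = 2 * of_real pi * \<i> * cis (2 * pi * t)" for t
    by (simp add: vector_derivative_circlepath cis_conv_exp mult_ac)
  ultimately show ?thesis
    unfolding circle_inner_def cinner_def contour_integral_integral
    by (intro integral_cong) (simp add: assms)
qed

lemma cis_reflect: "cis (2 * pi * (1 - t)) = cnj (cis (2 * pi * t))"
  by (simp add: complex_eq_iff right_diff_distrib cos_diff sin_diff)

lemma integral_reflect_unit:
  fixes f :: "real \<Rightarrow> 'a :: banach"
  assumes "continuous_on {0..1} f"
  shows "integral {0..1} (\<lambda>t. f (1 - t)) = integral {0..1} f"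
proof -
  have "(f has_integral integral {0..1} f) (cbox 0 1)"
    using integrable_integral[OF integrable_continuous_interval[OF assms]] by simp
  from has_integral_affinity[OF this, of "-1" 1]
  have "((\<lambda>t. f (1 - t)) has_integral integral {0..1} f) ((\<lambda>x::real. 1 - x) ` cbox 0 1)"
    by simp
  then show ?thesis
    by (simp add: image_diff_atLeastAtMost integral_unique)
qed

lemma cnj_poly_of_real:
  "cnj (poly (map_poly of_real p) z) = poly (map_poly of_real p) (cnj z)"
  by (induction p) (auto simp: map_poly_pCons)

text \<open>\<open>V t\<close> is the weight at exp(2 pi i t). Its symmetry means invariance under
  complex conjugation of the point, which makes the moments real.\<close>

locale circle_weight =
  fixes V :: "real \<Rightarrow> real"
  assumes continuous: "continuous_on {0..1} V"
    and positive: "t \<in> {0..1} \<Longrightarrow> 0 < V t"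
    and symmetric: "t \<in> {0..1} \<Longrightarrow> V (1 - t) = V t"
begin

lemma continuous_integrand:
  "continuous_on {0..1}
     (\<lambda>t. poly f (cis (2 * pi * t)) * cnj (poly g (cis (2 * pi * t))) * complex_of_real (V t))"
  by (intro continuous_intros continuous)

lemma integrable:
  "(\<lambda>t. poly f (cis (2 * pi * t)) * cnj (poly g (cis (2 * pi * t))) * complex_of_real (V t))
     integrable_on {0..1}"
  by (rule integrable_continuous_interval continuous_integrand)+

lemma cinner_add_left: "cinner V (f + g) h = cinner V f h + cinner V g h"
  unfolding cinner_def by (subst integral_add[symmetric, OF integrable integrable])
    (simp add: distrib_left distrib_right)

lemma cinner_smult_left: "cinner V (smult a f) h = a * cinner V f h"
  unfolding cinner_def by (subst integral_mult_right[symmetric]) (simp add: mult_ac)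

lemma cinner_cnj: "cnj (cinner V f g) = cinner V g f"
  unfolding cinner_def integral_cnj by (simp add: mult_ac)

lemma cinner_shift: "cinner V (pCons 0 f) (pCons 0 g) = cinner V f g"
proof -
  have "cis x * a * (cnj (cis x) * b) = a * b" for a b x
  proof -
    have "cis x * cnj (cis x) = 1" by (simp add: cis_cnj cis_mult)
    then show ?thesis by algebra
  qed
  then show ?thesis unfolding cinner_def poly_pCons complex_cnj_mult add_0 by (simp only:)
qed

lemma cinner_self_Re: "Re (cinner V f f) = integral {0..1} (\<lambda>t. (cmod (poly f (cis (2 * pi * t))))\<^sup>2 * V t)"
proof -
  have "Re (cinner V f f) = integral {0..1} (Re \<circ>
      (\<lambda>t. poly f (cis (2 * pi * t)) * cnj (poly f (cis (2 * pi * t))) * of_real (V t)))"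
    unfolding cinner_def by (rule integral_linear[symmetric, OF integrable bounded_linear_Re])
  also have "\<dots> = integral {0..1} (\<lambda>t. (cmod (poly f (cis (2 * pi * t))))\<^sup>2 * V t)"
    by (rule integral_cong) (simp add: complex_norm_square[symmetric] flip: of_real_mult)
  finally show ?thesis .
qed

text \<open>A continuous nonnegative integrand with integral zero vanishes identically, which would
  give \<open>f\<close> infinitely many roots on the circle.\<close>

lemma cinner_self_pos:
  assumes "f \<noteq> 0"
  shows "0 < Re (cinner V f f)"
proof -
  define u where "u = (\<lambda>t. (cmod (poly f (cis (2 * pi * t))))\<^sup>2 * V t)"
  have cont: "continuous_on {0..1} u"
    unfolding u_def by (intro continuous_intros continuous)
  have nonneg: "u t \<ge> 0" if "t \<in> {0..1}" for t
    using positive[OF that] by (simp add: u_def)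
  have "integral {0..1} u \<noteq> 0"
  proof
    assume "integral {0..1} u = 0"
    then have zero: "\<forall>t\<in>{0..1}. u t = 0"
      using cont nonneg by (subst (asm) integral_eq_0_iff) auto
    \<comment> \<open>The endpoint 1 is left out to keep the parametrization injective.\<close>
    have "(\<lambda>t. cis (2 * pi * t)) ` {0..<1} \<subseteq> {z. poly f z = 0}"
    proof safe
      fix t :: real assume t: "t \<in> {0..<1}"
      then have "u t = 0" "V t > 0" using zero positive by auto
      then show "poly f (cis (2 * pi * t)) = 0" by (simp add: u_def)
    qed
    then have "finite ((\<lambda>t. cis (2 * pi * t)) ` {0..<1})"
      using poly_roots_finite[OF assms] finite_subset by blast
    moreover have "inj_on (\<lambda>t. cis (2 * pi * t)) {0..<1}"
    proof (rule inj_onI)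
      fix s t :: real
      assume st: "s \<in> {0..<1}" "t \<in> {0..<1}" "cis (2 * pi * s) = cis (2 * pi * t)"
      then obtain n :: int where "2 * pi * s = 2 * pi * t + 2 * pi * n"
        using sin_cos_eq_iff[of "2 * pi * s" "2 * pi * t"] by (auto simp: complex_eq_iff)
      then have "s = t + n" by (simp flip: distrib_left)
      then show "s = t" using st by auto
    qed
    ultimately show False
      using finite_imageD infinite_Ico[of 0 "1::real"] by fastforce
  qed
  moreover have "integral {0..1} u \<ge> 0"
    using nonneg integral_nonneg[OF integrable_continuous_interval[OF cont]] by blast
  ultimately show ?thesis
    by (simp add: cinner_self_Re u_def)
qed

text \<open>The substitution t -> 1 - t conjugates the integrand, so the value equals its own
  conjugate.\<close>

lemma cinner_real: "cinner V (map_poly of_real f) (map_poly of_real g) \<in> \<real>"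
proof -
  let ?u = "\<lambda>t. poly (map_poly of_real f) (cis (2 * pi * t)) *
      cnj (poly (map_poly of_real g) (cis (2 * pi * t))) * complex_of_real (V t)"
  have "cinner V (map_poly of_real f) (map_poly of_real g) = integral {0..1} (\<lambda>t. ?u (1 - t))"
    unfolding cinner_def by (rule integral_reflect_unit[symmetric] continuous_integrand)+
  also have "\<dots> = integral {0..1} (\<lambda>t. cnj (?u t))"
    by (rule integral_cong) (simp add: cis_reflect symmetric cnj_poly_of_real)
  also have "\<dots> = cnj (cinner V (map_poly of_real f) (map_poly of_real g))"
    by (simp add: cinner_def integral_cnj)
  finally show ?thesis by (simp add: Reals_cnj_iff)
qed

end

text \<open>For a symmetric weight the real part discards nothing; it supplies the real-valued form
  that \<open>toeplitz_form\<close> expects.\<close>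

definition rinner :: "(real \<Rightarrow> real) \<Rightarrow> real poly \<Rightarrow> real poly \<Rightarrow> real" where
  "rinner V f g = Re (cinner V (map_poly of_real f) (map_poly of_real g))"

lemma map_poly_of_real_simps:
  "map_poly complex_of_real (f + g) = map_poly of_real f + map_poly of_real g"
  "map_poly complex_of_real (smult a f) = smult (of_real a) (map_poly of_real f)"
  "map_poly complex_of_real f = 0 \<longleftrightarrow> f = 0"
  by (auto simp: poly_eq_iff coeff_map_poly)

context circle_weight
begin

lemma cinner_of_real:
  "cinner V (map_poly of_real f) (map_poly of_real g) = of_real (rinner V f g)"
  using cinner_real by (simp add: rinner_def)

sublocale toeplitz_form "rinner V"
proof
  show "rinner V f g = rinner V g f" for f g
    unfolding rinner_def by (metis cinner_cnj cnj.simps(1))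
  show "rinner V (f + g) h = rinner V f h + rinner V g h" for f g h
    by (simp add: rinner_def map_poly_of_real_simps cinner_add_left)
  show "rinner V (smult a f) h = a * rinner V f h" for a f h
    by (simp add: rinner_def map_poly_of_real_simps cinner_smult_left)
  show "rinner V (pCons 0 f) (pCons 0 g) = rinner V f g" for f g
    by (simp add: rinner_def map_poly_pCons cinner_shift)
  show "0 < rinner V f f" if "f \<noteq> 0" for f
    using that by (simp add: rinner_def map_poly_of_real_simps cinner_self_pos)
qed

lemma monic_orthogonal_orth:
  assumes "\<forall>t\<in>{0..1}. w (cis (2 * pi * t)) = of_real (V t)"
  shows "monic_orthogonal w (\<lambda>n. map_poly of_real (P n))"
  unfolding monic_orthogonal_def circle_inner_eq_cinner[OF assms] cinner_of_real
  by (simp add: coeff_map_poly degree_map_poly orthogonal)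

text \<open>Two candidates of degree n are both orthogonal to everything of lower degree, hence to
  their difference, which is therefore orthogonal to itself. This justifies the definite description
  in \<open>opuc\<close>.\<close>

lemma monic_orthogonal_unique:
  assumes w: "\<forall>t\<in>{0..1}. w (cis (2 * pi * t)) = of_real (V t)"
    and p: "monic_orthogonal w p" and r: "monic_orthogonal w r"
  shows "p = r"
proof
  fix n
  \<comment> \<open>Subtracting the multiple of \<open>p (degree g)\<close> that cancels the leading
    term lowers the degree of \<open>g\<close>.\<close>
  have zero: "cinner V g (p n) = 0" if p: "monic_orthogonal w p" and g: "degree g < n" for p g
    using g
  proof (induction "degree g" arbitrary: g rule: less_induct)
    case less
    let ?d = "degree g" and ?c = "lead_coeff g"
    let ?r = "g - smult ?c (p ?d)"
    have "cinner V (p ?d) (p n) = 0"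
      using p less.prems by (auto simp: monic_orthogonal_def circle_inner_eq_cinner[OF w])
    moreover have "cinner V g (p n) = cinner V ?r (p n) + ?c * cinner V (p ?d) (p n)"
      using cinner_add_left[of ?r "smult ?c (p ?d)"] by (simp add: cinner_smult_left)
    moreover have "cinner V ?r (p n) = 0"
    proof (cases "?r = 0")
      case True
      then show ?thesis by (simp add: cinner_def)
    next
      case False
      have d: "degree (p ?d) = ?d" "lead_coeff (p ?d) = 1"
        using p unfolding monic_orthogonal_def by metis+
      have "degree ?r \<le> ?d"
        using d by (intro degree_diff_le order.trans[OF degree_smult_le]) auto
      moreover have "coeff ?r ?d = 0"
        using d by simp
      ultimately have "degree ?r < ?d"
        using False by (metis leading_coeff_0_iff le_neq_implies_less)
      then show ?thesis using less by (meson order.strict_trans)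
    qed
    ultimately show ?case by simp
  qed
  let ?g = "p n - r n"
  show "p n = r n"
  proof (rule ccontr)
    assume ne: "p n \<noteq> r n"
    have d: "degree (p n) = n" "coeff (p n) n = 1" "degree (r n) = n" "coeff (r n) n = 1"
      using p r by (auto simp: monic_orthogonal_def) metis+
    then have "degree ?g \<le> n" "coeff ?g n = 0"
      by (auto intro: degree_diff_le)
    then have "degree ?g < n"
      using ne by (metis eq_iff_diff_eq_0 leading_coeff_0_iff le_neq_implies_less)
    then have "cinner V ?g (p n) = 0" "cinner V ?g (r n) = 0"
      using zero p r by blast+
    then have "cinner V (p n) ?g = 0" "cinner V (r n) ?g = 0"
      using cinner_cnj by (metis complex_cnj_zero)+
    then have "cinner V ?g ?g = 0"
      using cinner_add_left[of ?g "r n" ?g] by simp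
    then show False
      using cinner_self_pos[of ?g] ne by simp
  qed
qed

lemma opuc_eq_orth:
  assumes "\<forall>t\<in>{0..1}. w (cis (2 * pi * t)) = of_real (V t)"
  shows "opuc w n = map_poly of_real (P n)"
proof -
  have "opuc w = (\<lambda>n. map_poly of_real (P n))"
    unfolding opuc_def
    by (rule the_equality)
      (use monic_orthogonal_unique[OF assms] monic_orthogonal_orth[OF assms] in blast)+
  then show ?thesis by simp
qed

lemma poly_opuc_0:
  assumes "\<forall>t\<in>{0..1}. w (cis (2 * pi * t)) = of_real (V t)"
  shows "poly (opuc w n) 0 = of_real (\<alpha> n)"
  by (simp add: opuc_eq_orth[OF assms] verblunsky_def poly_0_coeff_0 coeff_map_poly)

end

section \<open>The limit weight and integration by parts\<close>

lemma circle_weight_exp_cos: "circle_weight (\<lambda>t. exp (\<eta> * cos (2 * pi * t)))"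
proof
  show "continuous_on {0..1} (\<lambda>t. exp (\<eta> * cos (2 * pi * t)))"
    by (intro continuous_intros)
qed (simp_all add: right_diff_distrib cos_diff)

text \<open>The function f(z) g(1/z) exp(\<eta> (z + 1/z)) agrees at both ends of the loop, so its
  t-derivative integrates to zero. Differentiating the exponential yields the factor z - 1/z, and
  1/z is absorbed into the conjugated second argument.\<close>

lemma rinner_parts:
  fixes \<eta> :: real
  defines "V \<equiv> \<lambda>t. exp (2 * \<eta> * cos (2 * pi * t))"
  shows "rinner V (pCons 0 (pderiv f)) g - rinner V f (pCons 0 (pderiv g))
      + \<eta> * (rinner V (pCons 0 f) g - rinner V f (pCons 0 g)) = 0"
proof -
  interpret circle_weight V
    unfolding V_def by (rule circle_weight_exp_cos)
  define c where "c = 2 * of_real pi * \<i>"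
  let ?m = "map_poly complex_of_real"
  let ?F = "poly (?m f)" and ?G = "poly (?m g)"
  \<comment> \<open>Conjugation is not holomorphic, so 1/z is modelled by the entire function
    \<open>E'\<close>, which equals the conjugate of z for real arguments.\<close>
  define E where "E = (\<lambda>s::complex. exp (c * s))"
  define E' where "E' = (\<lambda>s::complex. exp (- c * s))"
  define e where "e t = cis (2 * pi * t)" for t
  define u where "u p q t = poly (?m p) (e t) * cnj (poly (?m q) (e t)) * complex_of_real (V t)" for p q t
  have u: "(u p q has_integral of_real (rinner V p q)) {0..1}" for p q
    using integrable_integral[OF integrable[of "?m p" "?m q"]]
    by (simp add: u_def[abs_def] e_def cinner_of_real[symmetric] cinner_def)
  have m_pderiv: "pderiv (?m p) = ?m (pderiv p)" for p
    by (simp add: poly_eq_iff coeff_pderiv coeff_map_poly)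
  have E: "E (of_real t) = e t" "E' (of_real t) = cnj (e t)" for t
    unfolding E_def E'_def e_def c_def cis_cnj by (simp_all add: cis_conv_exp mult_ac)
  define W where "W = (\<lambda>s. ?F (E s) * ?G (E' s) * exp (of_real \<eta> * (E s + E' s)))"
  have V: "exp (of_real \<eta> * (e t + cnj (e t))) = complex_of_real (V t)" for t
    by (simp add: complex_add_cnj V_def e_def exp_of_real[symmetric] mult_ac)
  have dE: "(E has_field_derivative c * E s) (at s)" "(E' has_field_derivative - c * E' s) (at s)" for s
    unfolding E_def E'_def by (auto intro!: derivative_eq_intros)
  have dF: "((\<lambda>s. ?F (E s)) has_field_derivative poly (?m (pderiv f)) (E s) * (c * E s)) (at s)" for s
    unfolding m_pderiv[symmetric] by (rule DERIV_chain2[OF poly_DERIV dE(1)])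
  have dG: "((\<lambda>s. ?G (E' s)) has_field_derivative poly (?m (pderiv g)) (E' s) * (- c * E' s)) (at s)" for s
    unfolding m_pderiv[symmetric] by (rule DERIV_chain2[OF poly_DERIV dE(2)])
  let ?W' = "\<lambda>t. c * (u (pCons 0 (pderiv f)) g t - u f (pCons 0 (pderiv g)) t
      + of_real \<eta> * (u (pCons 0 f) g t - u f (pCons 0 g) t))"
  have W01: "W (of_real 1) = W (of_real 0)"
    by (simp add: W_def E del: of_real_0 of_real_1) (simp add: e_def)
  have "((\<lambda>t. W (of_real t)) has_vector_derivative ?W' t) (at t within {0..1})" for t
  proof (rule has_vector_derivative_real_field)
    show "(W has_field_derivative ?W' t) (at (of_real t))"
      unfolding W_def
      by (rule derivative_eq_intros dF dG dE refl)+
        (simp add: E V[symmetric] u_def cnj_poly_of_real map_poly_pCons, algebra)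
  qed
  then have "(?W' has_integral W (of_real 1) - W (of_real 0)) {0..1}"
    by (intro fundamental_theorem_of_calculus) auto
  moreover have "(?W' has_integral c * of_real (rinner V (pCons 0 (pderiv f)) g - rinner V f (pCons 0 (pderiv g))
      + \<eta> * (rinner V (pCons 0 f) g - rinner V f (pCons 0 g)))) {0..1}"
    unfolding of_real_add of_real_diff of_real_mult
    by (intro has_integral_mult_right has_integral_add has_integral_diff u)
  ultimately have "c * of_real (rinner V (pCons 0 (pderiv f)) g - rinner V f (pCons 0 (pderiv g))
      + \<eta> * (rinner V (pCons 0 f) g - rinner V f (pCons 0 g))) = W (of_real 1) - W (of_real 0)"
    by (intro has_integral_unique)
  also have "\<dots> = 0"
    using W01 by (simp only: diff_self)
  finally show ?thesis
    unfolding mult_eq_0_iff of_real_eq_0_iff by (auto simp: c_def)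
qed

section \<open>Logarithm of the q-product weight\<close>

text \<open>The argument of the logarithm is |1 - a z|^2 at z = exp(2 pi i t), so this is the
  logarithm of one factor of the weight.\<close>

definition factor_log :: "real \<Rightarrow> real \<Rightarrow> real" where
  "factor_log t a = - ln (1 + (a\<^sup>2 - 2 * a * cos (2 * pi * t)))"

text \<open>With x = a^2 - 2 a cos(2 pi t), the bound 1/6 gives |x| <= 3 a <= 1/2, where |ln(1 + x)
  - x| <= 2 x^2 <= 18 a^2; the a^2 inside x makes 19. Then 19 a^2 + 2 a <= 6 a.\<close>

lemma factor_log_bound:
  assumes "0 \<le> a" "a \<le> 1 / 6"
  shows "\<bar>factor_log t a - 2 * a * cos (2 * pi * t)\<bar> \<le> 19 * a\<^sup>2"
    and "\<bar>factor_log t a\<bar> \<le> 6 * a"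
    and "0 < 1 + (a\<^sup>2 - 2 * a * cos (2 * pi * t))"
proof -
  define x where "x = a\<^sup>2 - 2 * a * cos (2 * pi * t)"
  have ac: "\<bar>2 * a * cos (2 * pi * t)\<bar> \<le> 2 * a"
    using assms mult_left_mono[OF abs_cos_le_one[of "2 * pi * t"], of "2 * a"] by (simp add: abs_mult)
  have a2: "0 \<le> a\<^sup>2" "a\<^sup>2 \<le> a * (1 / 6)"
    using mult_left_mono[OF assms(2,1)] by (simp_all add: power2_eq_square)
  have x: "\<bar>x\<bar> \<le> 3 * a"
    using ac a2 assms unfolding x_def by linarith
  then have "x\<^sup>2 \<le> (3 * a)\<^sup>2"
    by (intro power2_le_iff_abs_le[THEN iffD2]) (use assms in auto)
  moreover have ln: "\<bar>ln (1 + x) - x\<bar> \<le> 2 * x\<^sup>2"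
    using x assms by (intro abs_ln_one_plus_x_minus_x_bound) auto
  ultimately have 1: "\<bar>ln (1 + x) - x\<bar> \<le> 18 * a\<^sup>2"
    by (simp add: power_mult_distrib)
  then show 2: "\<bar>factor_log t a - 2 * a * cos (2 * pi * t)\<bar> \<le> 19 * a\<^sup>2"
    using a2 unfolding factor_log_def x_def[symmetric] by (simp add: x_def)
  show "\<bar>factor_log t a\<bar> \<le> 6 * a"
    using 2 a2 ac assms by linarith
  show "0 < 1 + (a\<^sup>2 - 2 * a * cos (2 * pi * t))"
    using x assms unfolding x_def by linarith
qed

definition log_weight :: "real \<Rightarrow> real \<Rightarrow> real \<Rightarrow> real" where
  "log_weight q \<xi> t = (\<Sum>k. factor_log t (\<xi> * q powr (real k + 1/2)))"

context
  fixes q \<xi> :: real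
  assumes q: "0 < q" "q < 1" and \<xi>: "0 \<le> \<xi>" "\<xi> \<le> 1 / 6"
begin

abbreviation "rate \<equiv> \<lambda>k::nat. \<xi> * q powr (real k + 1/2)"

lemma rate_eq: "rate k = \<xi> * sqrt q * q ^ k"
  using q by (simp add: powr_add powr_realpow powr_half_sqrt)

text \<open>A geometric series; for \<xi> = (1 - q) \<eta> its sum is \<eta> sqrt q, which fixes the
  exponent of the limit weight.\<close>

lemma rate_sums: "rate sums (\<xi> * sqrt q / (1 - q))"
  using sums_mult[OF geometric_sums[of q], of "\<xi> * sqrt q"] q by (simp add: rate_eq)

lemma rate_bounds: "0 \<le> rate k" "rate k \<le> \<xi>"
proof -
  show "0 \<le> rate k" using \<xi> by simp
  have "q powr (real k + 1/2) \<le> 1" using q by (intro powr_le1) auto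
  then show "rate k \<le> \<xi>" using \<xi> by (simp add: mult_left_le)
qed

lemma rate_bound': "rate k \<le> 1 / 6"
  using rate_bounds(2)[of k] \<xi> by simp

lemmas rate_log_bound = factor_log_bound[OF rate_bounds(1) rate_bound']

lemma summable_factor_log: "summable (\<lambda>k. factor_log t (rate k))"
  by (rule summable_comparison_test'[where g = "\<lambda>k. 6 * rate k" and N = 0])
    (use rate_log_bound(2) summable_mult[OF sums_summable[OF rate_sums]] in auto)

lemma I_weight_cis: "I_weight q \<xi> (cis (2 * pi * t)) = of_real (exp (log_weight q \<xi> t))"
proof -
  have factor: "inverse ((1 - of_real a * cis (2 * pi * t)) *
      (1 - of_real a * inverse (cis (2 * pi * t)))) = exp (of_real (factor_log t a))"
    if "0 < 1 + (a\<^sup>2 - 2 * a * cos (2 * pi * t))" for a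
  proof -
    have "(1 - of_real a * cis (2 * pi * t)) * (1 - of_real a * inverse (cis (2 * pi * t)))
        = of_real (1 + (a\<^sup>2 - 2 * a * cos (2 * pi * t)))"
      using sin_squared_eq[of "2 * pi * t"] by (simp add: complex_eq_iff) algebra
    then have "inverse ((1 - of_real a * cis (2 * pi * t)) *
        (1 - of_real a * inverse (cis (2 * pi * t)))) = of_real (exp (factor_log t a))"
      using that by (simp only: factor_log_def exp_minus exp_ln of_real_inverse)
    then show ?thesis by (simp only: exp_of_real)
  qed
  have "I_weight q \<xi> (cis (2 * pi * t)) = prodinf (\<lambda>k. exp (complex_of_real (factor_log t (rate k))))"
    unfolding I_weight_def using factor[OF rate_log_bound(3)] by (simp only:)
  also have "\<dots> = exp (\<Sum>k. complex_of_real (factor_log t (rate k)))"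
    by (rule prodinf_exp) (simp add: summable_factor_log summable_of_real)
  also have "\<dots> = of_real (exp (log_weight q \<xi> t))"
    by (simp add: log_weight_def suminf_of_real[OF summable_factor_log] flip: exp_of_real)
  finally show ?thesis .
qed

text \<open>Each quadratic error is at most 19 \<xi> times the rate, so the total is 19 \<xi> times
  the sum of the rates. For \<xi> = (1 - q) \<eta> this is O(1 - q), uniformly in
  \<open>t\<close>.\<close>

lemma log_weight_approx:
  "\<bar>log_weight q \<xi> t - 2 * (\<xi> * sqrt q / (1 - q)) * cos (2 * pi * t)\<bar> \<le> 19 * \<xi> * (\<xi> * sqrt q / (1 - q))"
proof -
  have s: "(\<lambda>k. 2 * rate k * cos (2 * pi * t)) sums (2 * (\<xi> * sqrt q / (1 - q)) * cos (2 * pi * t))"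
    by (intro sums_mult sums_mult2 rate_sums)
  have 1: "(\<lambda>k. factor_log t (rate k) - 2 * rate k * cos (2 * pi * t)) sums
      (log_weight q \<xi> t - 2 * (\<xi> * sqrt q / (1 - q)) * cos (2 * pi * t))"
    unfolding log_weight_def by (intro sums_diff summable_sums summable_factor_log s)
  have 2: "(\<lambda>k. 19 * \<xi> * rate k) sums (19 * \<xi> * (\<xi> * sqrt q / (1 - q)))"
    by (intro sums_mult rate_sums)
  have 3: "norm (factor_log t (rate k) - 2 * rate k * cos (2 * pi * t)) \<le> 19 * \<xi> * rate k" for k
  proof -
    have "(rate k)\<^sup>2 \<le> \<xi> * rate k"
      unfolding power2_eq_square by (intro mult_right_mono rate_bounds)
    then show ?thesis using rate_log_bound(1)[of t k] by simp
  qed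
  show ?thesis
    using norm_sums_le[OF 1 2 3] by simp
qed

lemma circle_weight_exp_log_weight: "circle_weight (\<lambda>t. exp (log_weight q \<xi> t))"
proof
  \<comment> \<open>The majorant \<open>6 * rate k\<close> is independent of \<open>t\<close>, so
    continuity passes from the partial sums to the series.\<close>
  have "uniform_limit {0..1} (\<lambda>n t. \<Sum>k<n. factor_log t (rate k)) (log_weight q \<xi>) sequentially"
    unfolding log_weight_def
    by (rule Weierstrass_m_test[where M = "\<lambda>k. 6 * rate k"])
      (use rate_log_bound(2) summable_mult[OF sums_summable[OF rate_sums]] in auto)
  moreover have "continuous_on {0..1} (\<lambda>t. factor_log t (rate k))" for k
    unfolding factor_log_def using rate_log_bound(3)[of k]
    by (intro continuous_intros) (metis less_irrefl)
  ultimately have "continuous_on {0..1} (log_weight q \<xi>)"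
    by (intro uniform_limit_theorem) (auto intro!: always_eventually continuous_on_sum)
  then show "continuous_on {0..1} (\<lambda>t. exp (log_weight q \<xi> t))"
    by (intro continuous_intros)
  show "exp (log_weight q \<xi> (1 - t)) = exp (log_weight q \<xi> t)" for t
    by (simp add: log_weight_def factor_log_def right_diff_distrib cos_diff)
qed auto

end


section \<open>Passage to the limit q -> 1\<close>

text \<open>The polynomial factor is bounded by some M on the circle, so an error below \<epsilon> /
  (2 M) in the weight changes the integral by at most \<epsilon> / 2.\<close>

lemma rinner_tendsto:
  assumes V: "circle_weight V" and W: "\<forall>\<^sub>F q in F. circle_weight (W q)"
    and lim: "uniform_limit {0..1} W V F"
  shows "((\<lambda>q. rinner (W q) f g) \<longlongrightarrow> rinner V f g) F"
proof -
  let ?m = "map_poly complex_of_real"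
  define p where "p t = poly (?m f) (cis (2 * pi * t)) * cnj (poly (?m g) (cis (2 * pi * t)))" for t
  have p_cont: "continuous_on {0..1} p"
    unfolding p_def by (intro continuous_intros)
  then have "bounded (p ` {0..1})"
    by (intro compact_imp_bounded compact_continuous_image) auto
  then obtain M where M: "M > 0" "\<And>t. t \<in> {0..1} \<Longrightarrow> cmod (p t) \<le> M"
    unfolding bounded_pos by auto
  have int: "(\<lambda>t. p t * of_real (U t)) integrable_on {0..1}" if "circle_weight U" for U
    unfolding p_def by (rule circle_weight.integrable[OF that])
  have "((\<lambda>q. cinner (W q) (?m f) (?m g)) \<longlongrightarrow> cinner V (?m f) (?m g)) F"
  proof (rule tendstoI)
    fix \<epsilon> :: real
    assume \<epsilon>: "\<epsilon> > 0"
    have "\<forall>\<^sub>F q in F. \<forall>t\<in>{0..1}. dist (W q t) (V t) < \<epsilon> / (2 * M)"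
      using lim \<epsilon> M(1) by (intro uniform_limitD) auto
    with W show "\<forall>\<^sub>F q in F. dist (cinner (W q) (?m f) (?m g)) (cinner V (?m f) (?m g)) < \<epsilon>"
    proof eventually_elim
      case (elim q)
      have "cinner (W q) (?m f) (?m g) - cinner V (?m f) (?m g)
          = integral {0..1} (\<lambda>t. p t * of_real (W q t) - p t * of_real (V t))"
        unfolding cinner_def p_def[symmetric]
        by (intro integral_diff[symmetric] int V elim)
      also have "norm \<dots> \<le> (\<epsilon> / 2) * (1 - 0)"
      proof (rule integral_bound)
        show "continuous_on {0..1} (\<lambda>t. p t * of_real (W q t) - p t * of_real (V t))"
          by (intro continuous_intros p_cont circle_weight.continuous V elim)
        fix t :: real
        assume t: "t \<in> {0..1}"
        have "norm (p t * of_real (W q t) - p t * of_real (V t)) = cmod (p t) * dist (W q t) (V t)"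
          by (simp add: dist_norm norm_mult flip: right_diff_distrib of_real_diff)
        also have "\<dots> \<le> M * (\<epsilon> / (2 * M))"
          using elim t M(1) by (intro mult_mono M(2)) (auto intro: less_imp_le)
        finally show "norm (p t * of_real (W q t) - p t * of_real (V t)) \<le> \<epsilon> / 2"
          using M(1) by simp
      qed simp
      finally show ?case
        using \<epsilon> by (simp add: dist_norm)
    qed
  qed
  then show ?thesis
    unfolding rinner_def by (rule tendsto_Re)
qed

lemma eventually_at_left_1_small:
  fixes \<eta> :: real
  assumes "\<eta> > 0"
  shows "\<forall>\<^sub>F q in at_left 1. 0 < q \<and> q < 1 \<and> 0 \<le> (1 - q) * \<eta> \<and> (1 - q) * \<eta> \<le> 1 / 6"
proof -
  have "((\<lambda>q. (1 - q) * \<eta>) \<longlongrightarrow> (1 - 1) * \<eta>) (at_left 1)"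
    by (intro tendsto_intros)
  then have "\<forall>\<^sub>F q in at_left 1. (1 - q) * \<eta> < 1 / 6"
    by (rule order_tendstoD) simp
  moreover have "\<forall>\<^sub>F q in at_left 1. q \<in> {0<..<1::real}"
    by (rule eventually_at_leftI[of 0]) auto
  ultimately show ?thesis
    by eventually_elim (use assms in auto)
qed

text \<open>Two errors, both independent of \<open>t\<close>, make up \<open>\<delta>\<close>: the
  quadratic terms of the factor logarithms, and the replacement of \<eta> sqrt q by \<eta>.\<close>

lemma weight_uniform_limit:
  fixes \<eta> :: real
  assumes \<eta>: "\<eta> > 0"
  shows "uniform_limit {0..1} (\<lambda>q t. exp (log_weight q ((1 - q) * \<eta>) t))
      (\<lambda>t. exp (2 * \<eta> * cos (2 * pi * t))) (at_left 1)"
proof -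
  let ?L = "\<lambda>t. 2 * \<eta> * cos (2 * pi * t)"
  define \<delta> where "\<delta> q = 19 * ((1 - q) * \<eta>) * (\<eta> * sqrt q) + 2 * \<eta> * \<bar>sqrt q - 1\<bar>" for q
  have "(\<delta> \<longlongrightarrow> 19 * ((1 - 1) * \<eta>) * (\<eta> * sqrt 1) + 2 * \<eta> * \<bar>sqrt 1 - 1\<bar>) (at_left 1)"
    unfolding \<delta>_def by (intro tendsto_intros)
  then have \<delta>_lim: "(\<delta> \<longlongrightarrow> 0) (at_left 1)"
    by simp
  have \<delta>: "\<forall>\<^sub>F q in at_left 1. \<forall>t. \<bar>log_weight q ((1 - q) * \<eta>) t - ?L t\<bar> \<le> \<delta> q"
    using eventually_at_left_1_small[OF \<eta>]
  proof eventually_elim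
    case (elim q)
    show ?case
    proof
      fix t
      have "\<bar>log_weight q ((1 - q) * \<eta>) t - 2 * (\<eta> * sqrt q) * cos (2 * pi * t)\<bar>
          \<le> 19 * ((1 - q) * \<eta>) * (\<eta> * sqrt q)"
        using log_weight_approx[of q "(1 - q) * \<eta>" t] elim by simp
      moreover have "\<bar>2 * (\<eta> * sqrt q) * cos (2 * pi * t) - ?L t\<bar> \<le> 2 * \<eta> * \<bar>sqrt q - 1\<bar>"
      proof -
        have "2 * (\<eta> * sqrt q) * cos (2 * pi * t) - ?L t = 2 * \<eta> * (sqrt q - 1) * cos (2 * pi * t)"
          by (simp add: algebra_simps)
        then show ?thesis
          using \<eta> mult_left_mono[OF abs_cos_le_one[of "2 * pi * t"], of "2 * \<eta> * \<bar>sqrt q - 1\<bar>"]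
          by (simp add: abs_mult)
      qed
      ultimately show "\<bar>log_weight q ((1 - q) * \<eta>) t - ?L t\<bar> \<le> \<delta> q"
        unfolding \<delta>_def by linarith
    qed
  qed
  have "uniform_limit {0..1} (\<lambda>q t. log_weight q ((1 - q) * \<eta>) t) ?L (at_left 1)"
  proof (rule uniform_limitI)
    fix \<epsilon> :: real
    assume "\<epsilon> > 0"
    then have "\<forall>\<^sub>F q in at_left 1. \<delta> q < \<epsilon>"
      by (rule order_tendstoD(2)[OF \<delta>_lim])
    with \<delta> show "\<forall>\<^sub>F q in at_left 1. \<forall>t\<in>{0..1}. dist (log_weight q ((1 - q) * \<eta>) t) (?L t) < \<epsilon>"
    proof eventually_elim
      case (elim q)
      show ?case
        unfolding dist_real_def using elim by (blast intro: order.strict_trans1)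
    qed
  qed
  then show ?thesis
  \<comment> \<open>The exponential is uniformly continuous only on bounded sets. The limit exponent
    has modulus at most 2 \<eta>, and once \<open>\<delta> q < 1\<close> the approximants stay
    within distance 1 of it.\<close>
  proof (rule uniform_limit_compose_uniformly_continuous_on[where B = "{- (2 * \<eta> + 1)..2 * \<eta> + 1}"])
    show "uniformly_continuous_on {- (2 * \<eta> + 1)..2 * \<eta> + 1} (exp :: real \<Rightarrow> real)"
      by (intro compact_uniformly_continuous continuous_intros) auto
    have "\<bar>?L t\<bar> \<le> 2 * \<eta>" for t
      using \<eta> mult_left_mono[OF abs_cos_le_one[of "2 * pi * t"], of "2 * \<eta>"] by (simp add: abs_mult)
    then have L: "- (2 * \<eta>) \<le> ?L t" "?L t \<le> 2 * \<eta>" for t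
      by (auto simp: abs_le_iff minus_le_iff)
    have "\<forall>\<^sub>F q in at_left 1. \<delta> q < 1"
      using \<delta>_lim by (rule order_tendstoD) simp
    with \<delta> show "\<forall>\<^sub>F q in at_left 1. \<forall>t\<in>{0..1}.
        log_weight q ((1 - q) * \<eta>) t \<in> {- (2 * \<eta> + 1)..2 * \<eta> + 1}"
    proof eventually_elim
      case (elim q)
      show ?case
      proof
        fix t :: real
        show "log_weight q ((1 - q) * \<eta>) t \<in> {- (2 * \<eta> + 1)..2 * \<eta> + 1}"
          using spec[OF elim(1), of t] elim(2) L[of t] by (simp add: abs_le_iff)
      qed
    qed
  qed auto
qed

theorem corollary4p8:
  fixes \<eta> :: real
  assumes "\<eta> > 0"
  shows "\<exists>x :: nat \<Rightarrow> complex.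
     (\<forall>n. ((\<lambda>q. poly (opuc (I_weight q ((1 - q) * \<eta>)) n) 0) \<longlongrightarrow> x n) (at_left (1::real))) \<and>
     (\<forall>n\<ge>1. (x (n - 1) + x (n + 1)) * (1 - (x n)\<^sup>2) + of_real (real n / \<eta>) * x n = 0)"
proof -
  define V where "V t = exp (2 * \<eta> * cos (2 * pi * t))" for t
  define W where "W q t = exp (log_weight q ((1 - q) * \<eta>) t)" for q t
  interpret V: circle_weight V
    unfolding V_def[abs_def] by (rule circle_weight_exp_cos)
  have W: "\<forall>\<^sub>F q in at_left 1. circle_weight (W q)"
    using eventually_at_left_1_small[OF assms]
    by eventually_elim (simp add: W_def[abs_def] circle_weight_exp_log_weight)
  have lim: "uniform_limit {0..1} W V (at_left 1)"
    using weight_uniform_limit[OF assms] unfolding V_def[abs_def] W_def[abs_def] .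
  define a where "a = verblunsky (rinner V)"
  have "((\<lambda>q. poly (opuc (I_weight q ((1 - q) * \<eta>)) n) 0) \<longlongrightarrow> of_real (a n)) (at_left 1)" for n
  proof -
    have "((\<lambda>q. verblunsky (rinner (W q)) n) \<longlongrightarrow> a n) (at_left 1)"
      unfolding verblunsky_def a_def
    proof (rule szego_tendsto(1))
      show "toeplitz_form (rinner V)" by (rule V.toeplitz_form_axioms)
      show "\<forall>\<^sub>F q in at_left 1. toeplitz_form (rinner (W q))"
        using W
      proof eventually_elim
        case (elim q)
        interpret circle_weight "W q" by fact
        show ?case by (rule toeplitz_form_axioms)
      qed
    qed (intro rinner_tendsto V.circle_weight_axioms W lim)
    then have "((\<lambda>q. complex_of_real (verblunsky (rinner (W q)) n)) \<longlongrightarrow> of_real (a n)) (at_left 1)"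
      by (rule tendsto_of_real)
    \<comment> \<open>The identification with \<open>opuc\<close> is available for \<open>q\<close>
      close to 1, where the logarithm estimates hold, and this is enough for the limit.\<close>
    moreover have "\<forall>\<^sub>F q in at_left 1. complex_of_real (verblunsky (rinner (W q)) n) =
        poly (opuc (I_weight q ((1 - q) * \<eta>)) n) 0"
      using W eventually_at_left_1_small[OF assms]
      by eventually_elim (simp add: circle_weight.poly_opuc_0 I_weight_cis W_def)
    ultimately show ?thesis
      by (rule Lim_transform_eventually)
  qed
  moreover have "(complex_of_real (a (n - 1)) + of_real (a (n + 1))) * (1 - (of_real (a n))\<^sup>2)
      + of_real (real n / \<eta>) * of_real (a n) = 0" if "n \<ge> 1" for n
  proof -
    have "\<eta> * ((a (n - 1) + a (n + 1)) * (1 - (a n)\<^sup>2)) + real n * a n = 0"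
      unfolding a_def V_def[abs_def]
      using V.discrete_painleve[OF rinner_parts[of \<eta>, folded V_def] that]
      by (simp add: V_def[abs_def])
    then have "(a (n - 1) + a (n + 1)) * (1 - (a n)\<^sup>2) + real n / \<eta> * a n = 0"
      using assms by (simp add: field_simps)
    then have "complex_of_real ((a (n - 1) + a (n + 1)) * (1 - (a n)\<^sup>2) + real n / \<eta> * a n) = 0"
      by (simp only: of_real_0)
    then show ?thesis
      by (simp only: of_real_add of_real_mult of_real_diff of_real_power of_real_1)
  qed
  ultimately show ?thesis
    by (intro exI[of _ "\<lambda>n. of_real (a n)"]) blast
qed

end
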